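(* Let $k$ be a positive integer and $n$ an even positive integer. If $G$ is a connected graph on $n$ vertices with $|E(G)|\geqslant\binom{n-1}{2}+2k$, then $G$ is $k$-extendable, unless $G$ is isomorphic to $K_{2k}\vee(K_{n-2k-1}\cup K_1)$ or to $K_{2k+1}\vee 3K_1$.
   Context: All graphs are finite, simple and undirected. A matching is a set of pairwise vertex-disjoint edges; it is perfect if it covers all vertices. A graph with at least $2k+2$ vertices that has a perfect matching is called $k$-extendable if every matching of size $k$ is contained in some perfect matching. $K_r$ is the complete graph on $r$ vertices; $tK_1$ is the edgeless graph on $t$ vertices; $G_1\cup G_2$ is the disjoint union; the join $G_1\vee G_2$ is obtained from $G_1\cup G_2$ by adding all edges between $V(G_1)$ and $V(G_2)$. *)

theory Defs
  imports "HOL-Library.Ramsey"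
begin

type_synonym 'a graph = "'a set \<times> 'a set set"

abbreviation verts :: "'a graph \<Rightarrow> 'a set" where
  "verts G \<equiv> fst G"

abbreviation edges :: "'a graph \<Rightarrow> 'a set set" where
  "edges G \<equiv> snd G"

definition finite_simple_graph :: "'a graph \<Rightarrow> bool" where
  "finite_simple_graph G \<longleftrightarrow> finite (verts G) \<and> edges G \<subseteq> [verts G]\<^bsup>2\<^esup>"

definition connected_graph :: "'a graph \<Rightarrow> bool" where
  "connected_graph G \<longleftrightarrow> verts G \<noteq> {} \<and>
     (\<forall>u\<in>verts G. \<forall>v\<in>verts G. (u, v) \<in> {(x, y). {x, y} \<in> edges G}\<^sup>*)"

definition matching :: "'a graph \<Rightarrow> 'a set set \<Rightarrow> bool" where
  "matching G M \<longleftrightarrow> M \<subseteq> edges G \<and> pairwise disjnt M"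

definition perfect_matching :: "'a graph \<Rightarrow> 'a set set \<Rightarrow> bool" where
  "perfect_matching G M \<longleftrightarrow> matching G M \<and> \<Union>M = verts G"

definition extendable :: "nat \<Rightarrow> 'a graph \<Rightarrow> bool" where
  "extendable k G \<longleftrightarrow>
     card (verts G) \<ge> 2 * k + 2 \<and>
     (\<exists>P. perfect_matching G P) \<and>
     (\<forall>M. matching G M \<and> card M = k \<longrightarrow> (\<exists>P. perfect_matching G P \<and> M \<subseteq> P))"

definition graph_iso :: "'a graph \<Rightarrow> 'b graph \<Rightarrow> bool" (infix \<open>\<cong>\<^sub>G\<close> 50) where
  "G \<cong>\<^sub>G H \<longleftrightarrow> (\<exists>f. bij_betw f (verts G) (verts H) \<and>
     (\<forall>u\<in>verts G. \<forall>v\<in>verts G. {u, v} \<in> edges G \<longleftrightarrow> {f u, f v} \<in> edges H))"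

definition complete_graph :: "nat \<Rightarrow> nat graph" where
  "complete_graph r = ({..<r}, [{..<r}]\<^bsup>2\<^esup>)"

definition edgeless_graph :: "nat \<Rightarrow> nat graph" where
  "edgeless_graph t = ({..<t}, {})"

definition disjoint_union :: "'a graph \<Rightarrow> 'b graph \<Rightarrow> ('a + 'b) graph" where
  "disjoint_union G H =
     (verts G <+> verts H, image Inl ` edges G \<union> image Inr ` edges H)"

definition join :: "'a graph \<Rightarrow> 'b graph \<Rightarrow> ('a + 'b) graph" where
  "join G H =
     (verts (disjoint_union G H),
      edges (disjoint_union G H) \<union> {{Inl u, Inr v} | u v. u \<in> verts G \<and> v \<in> verts H})"

end

theory Submission
  imports Defs
begin

text \<open>
  The graph misses at most \<open>n - 1 - 2k\<close> edges. Deleting the \<open>2k\<close> vertices of a matching of size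
  \<open>k\<close> leaves an even number \<open>m = n - 2k\<close> of vertices with at most \<open>m - 1\<close> missing edges. Such a graph
  has a perfect matching unless the missing edges form a spanning star, or a triangle with \<open>m = 4\<close>:
  for \<open>m \<ge> 6\<close>, match two adjacent vertices that meet at least two missing edges and induct.
  In the exceptional cases exactly \<open>m - 1\<close> edges are missing, so no missing edge meets the
  deleted vertices, and this determines the whole graph.
\<close>

section \<open>Perfect matchings when few edges are missing\<close>

lemma perfect_matching_insert_pair:
  assumes "perfect_matching (V - {u, w}, [V - {u, w}]\<^bsup>2\<^esup> - F') P"
    and "u \<in> V" "w \<in> V" "u \<noteq> w" "{u, w} \<notin> F"
    and "F' = {e \<in> F. u \<notin> e \<and> w \<notin> e}"
  shows "perfect_matching (V, [V]\<^bsup>2\<^esup> - F) (insert {u, w} P)"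
proof -
  have P: "P \<subseteq> [V - {u, w}]\<^bsup>2\<^esup> - F'" "pairwise disjnt P" "\<Union>P = V - {u, w}"
    using assms(1) by (auto simp: perfect_matching_def matching_def)
  have avoid: "u \<notin> e" "w \<notin> e" if "e \<in> P" for e
    using P(3) that by blast+
  have "P \<subseteq> [V]\<^bsup>2\<^esup> - F"
    using P(1) avoid assms(6) by (auto simp: nsets_def)
  moreover have "{u, w} \<in> [V]\<^bsup>2\<^esup> - F"
    using assms by (auto simp: nsets_def)
  moreover have "pairwise disjnt (insert {u, w} P)"
    using P(2) avoid by (auto simp: pairwise_insert disjnt_def)
  moreover have "\<Union>(insert {u, w} P) = V"
    using P(3) assms by auto
  ultimately show ?thesis
    by (auto simp: perfect_matching_def matching_def)
qed

definition star_edges :: "'a \<Rightarrow> 'a set \<Rightarrow> 'a set set" where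
  "star_edges c V = (\<lambda>v. {c, v}) ` (V - {c})"

lemma card_star_edges:
  assumes "finite V" "c \<in> V"
  shows "card (star_edges c V) = card V - 1"
proof -
  have "inj_on (\<lambda>v. {c, v}) (V - {c})"
    by (auto simp: inj_on_def doubleton_eq_iff)
  then show ?thesis
    using assms by (simp add: star_edges_def card_image)
qed

text \<open>Here \<open>F\<close> is read as the set of missing edges. A full star isolates its
  centre; a missing triangle on four vertices leaves only the claw with three leaves, whose single
  centre cannot serve all of them.\<close>

definition blocking :: "'a set \<Rightarrow> 'a set set \<Rightarrow> bool" where
  "blocking V F \<longleftrightarrow> (\<exists>c\<in>V. F = star_edges c V)
     \<or> card V = 4 \<and> (\<exists>T\<subseteq>V. card T = 3 \<and> F = [T]\<^bsup>2\<^esup>)"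

text \<open>Both obstructions have the same size, the largest compatible with
  \<open>card F < card V\<close>. Counting alone therefore excludes them as soon as one more edge is
  known to be present.\<close>

lemma card_blocking:
  assumes "finite V" "blocking V F"
  shows "card F = card V - 1"
  using assms by (auto simp: blocking_def card_star_edges card_nsets choose_two)

lemma nsets_2_triple:
  assumes "distinct [a, b, c]"
  shows "[{a, b, c}]\<^bsup>2\<^esup> = {{a, b}, {a, c}, {b, c}}"
  using assms by (auto simp: nsets_2_eq)

lemma two_vertices:
  assumes "card V = 2" "F \<subseteq> [V]\<^bsup>2\<^esup>"
  shows "(\<exists>P. perfect_matching (V, [V]\<^bsup>2\<^esup> - F) P) \<or> blocking V F"
proof -
  obtain a b where V: "V = {a, b}" "a \<noteq> b"
    using assms(1) by (auto simp: card_2_iff)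
  have V2: "[V]\<^bsup>2\<^esup> = {{a, b}}"
    using V by (auto simp: nsets_2_eq)
  have S: "star_edges a V = {{a, b}}"
    using V by (auto simp: star_edges_def)
  show ?thesis
  proof (cases "F = {}")
    case True
    then have "perfect_matching (V, [V]\<^bsup>2\<^esup> - F) {{a, b}}"
      using V2 V by (auto simp: perfect_matching_def matching_def)
    then show ?thesis by blast
  next
    case False
    then have "F = star_edges a V"
      using assms(2) V2 S by auto
    then show ?thesis using V by (auto simp: blocking_def)
  qed
qed

text \<open>The four vertices have three possible perfect matchings, pairwise edge-disjoint, and
  each must lose an edge. As at most three edges are missing, \<open>F\<close> takes exactly one
  edge from each; any such choice is a star or a triangle.\<close>

lemma four_vertices:
  assumes "card V = 4" "F \<subseteq> [V]\<^bsup>2\<^esup>" "card F < card V"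
  shows "(\<exists>P. perfect_matching (V, [V]\<^bsup>2\<^esup> - F) P) \<or> blocking V F"
proof (rule disjCI)
  assume "\<not> blocking V F"
  have "finite V" using assms(1) by (metis card.infinite zero_neq_numeral)
  then have finF: "finite F"
    using assms(2) finite_imp_finite_nsets finite_subset by blast
  have F3: "card F \<le> 3" using assms by auto
  have "card V = Suc (Suc (Suc (Suc 0)))" using assms(1) by simp
  then obtain a b c d where V: "V = {a, b, c, d}" and dist: "distinct [a, b, c, d]"
    by (auto simp: card_Suc_eq)
  have exact: "F = S" if "S \<subseteq> F" "card S = 3" for S
    using that F3 finF by (metis card_mono card_subset_eq le_antisym)
  have pm: "(\<exists>P. perfect_matching (V, [V]\<^bsup>2\<^esup> - F) P)"
    if "V = {p, q, r, s}" "distinct [p, q, r, s]" "{p, q} \<notin> F" "{r, s} \<notin> F" for p q r s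
  proof -
    have "perfect_matching (V, [V]\<^bsup>2\<^esup> - F) {{p, q}, {r, s}}"
      using that
      by (auto simp: perfect_matching_def matching_def nsets_2_eq pairwise_def disjnt_def)
    then show ?thesis by blast
  qed
  have star: False
    if "V = {p, q, r, s}" "distinct [p, q, r, s]" "{p, q} \<in> F" "{p, r} \<in> F" "{p, s} \<in> F"
    for p q r s
  proof -
    have eq: "star_edges p V = {{p, q}, {p, r}, {p, s}}"
      using that by (auto simp: star_edges_def)
    then have "F = star_edges p V"
      using exact[of "star_edges p V"] that \<open>finite V\<close> assms(1) card_star_edges[of V p] by auto
    then show False using \<open>\<not> blocking V F\<close> that by (auto simp: blocking_def)
  qed
  have triangle: False
    if "V = {p, q, r, s}" "distinct [p, q, r, s]" "{p, q} \<in> F" "{p, r} \<in> F" "{q, r} \<in> F"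
    for p q r s
  proof -
    have T: "[{p, q, r}]\<^bsup>2\<^esup> = {{p, q}, {p, r}, {q, r}}" "card {p, q, r} = 3"
      using that nsets_2_triple[of p q r] by auto
    then have "F = [{p, q, r}]\<^bsup>2\<^esup>"
      using exact[of "[{p, q, r}]\<^bsup>2\<^esup>"] that card_nsets[of "{p, q, r}" 2] by (auto simp: choose_two)
    moreover have "{p, q, r} \<subseteq> V" using that by auto
    ultimately show False
      using \<open>\<not> blocking V F\<close> assms(1) T(2) unfolding blocking_def by blast
  qed
  show "\<exists>P. perfect_matching (V, [V]\<^bsup>2\<^esup> - F) P"
  proof (rule ccontr)
    assume no: "\<not> ?thesis"
    have perms: "V = {a, c, b, d}" "V = {a, d, b, c}" "V = {b, a, c, d}" "V = {c, a, b, d}"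
      "V = {d, a, b, c}" "V = {a, b, d, c}" "V = {a, c, d, b}" "V = {b, c, d, a}"
      using V by auto
    have "{a, b} \<in> F \<or> {c, d} \<in> F" "{a, c} \<in> F \<or> {b, d} \<in> F" "{a, d} \<in> F \<or> {b, c} \<in> F"
      using pm[OF V] pm[OF perms(1)] pm[OF perms(2)] no dist by auto
    \<comment> \<open>The eight ways to choose one edge from each pair are the four stars and the
      four triangles, one of each for every instance supplied.\<close>
    then show False
      using star[OF V] star[OF perms(3)] star[OF perms(4)] star[OF perms(5)]
        triangle[OF V] triangle[OF perms(6)] triangle[OF perms(7)] triangle[OF perms(8)] dist
      by (auto simp: insert_commute)
  qed
qed

text \<open>If every other vertex were joined to \<open>u\<close> by a missing edge, the full star
  at \<open>u\<close> would already use up all edges that \<open>F\<close> may have, so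
  \<open>F\<close> would be that star.\<close>

lemma exists_nonadjacent:
  assumes "finite V" "u \<in> V" "F \<subseteq> [V]\<^bsup>2\<^esup>" "card F < card V" "\<not> blocking V F"
  obtains w where "w \<in> V" "w \<noteq> u" "{u, w} \<notin> F"
proof -
  have "finite F"
    using assms finite_imp_finite_nsets finite_subset by blast
  have "\<not> star_edges u V \<subseteq> F"
  proof
    assume sub: "star_edges u V \<subseteq> F"
    moreover have "card F \<le> card (star_edges u V)"
      using assms by (simp add: card_star_edges)
    ultimately have "F = star_edges u V"
      using \<open>finite F\<close> by (metis card_seteq)
    then show False using assms by (auto simp: blocking_def)
  qed
  then show ?thesis using that by (auto simp: star_edges_def)
qed

text \<open>Strong induction on \<open>card V\<close>. From six vertices on, a counterexample is
  refuted by bounding the number of missing edges at a vertex, first by two and then by one, each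
  time deleting a suitable adjacent pair.\<close>

lemma perfect_matching_avoiding:
  assumes "finite V" "even (card V)" "F \<subseteq> [V]\<^bsup>2\<^esup>" "card F < card V"
  shows "(\<exists>P. perfect_matching (V, [V]\<^bsup>2\<^esup> - F) P) \<or> blocking V F"
  using assms
proof (induction "card V" arbitrary: V F rule: less_induct)
  case less
  note finV = less.prems(1) and evenV = less.prems(2) and F2 = less.prems(3)
    and cardF = less.prems(4)
  have finF: "finite F"
    using F2 finV finite_imp_finite_nsets finite_subset by blast
  consider "card V = 2" | "card V = 4" | "card V \<ge> 6"
  proof -
    have "card V \<noteq> 0" "card V \<noteq> 1" "card V \<noteq> 3" "card V \<noteq> 5" using evenV cardF by auto
    then show ?thesis using that by linarith
  qed
  then show ?case
  proof cases
    case 1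
    then show ?thesis using two_vertices F2 by blast
  next
    case 2
    then show ?thesis using four_vertices F2 cardF by blast
  next
    case 3
    \<comment> \<open>\<open>card (D x)\<close> is the degree of \<open>x\<close> in the graph of
      missing edges.\<close>
    define D where "D x = {e \<in> F. x \<in> e}" for x
    have finD: "finite (D x)" for x
      using finF by (auto simp: D_def)
    show ?thesis
    proof (rule disjCI)
      assume unblocked: "\<not> blocking V F"
      \<comment> \<open>\<open>card V - 3\<close> is one less than the number of vertices left, so
        the induction hypothesis applies. A perfect matching of the rest extends by
        \<open>{u, w}\<close>; otherwise the rest is blocked and the bound is attained.\<close>
      have delete: "(\<exists>P. perfect_matching (V, [V]\<^bsup>2\<^esup> - F) P) \<or>
          card F' = card V - 3 \<and> blocking (V - {u, w}) F'"
        if uw: "u \<in> V" "w \<in> V" "u \<noteq> w" "{u, w} \<notin> F"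
          and F': "F' = {e \<in> F. u \<notin> e \<and> w \<notin> e}" and "card F' \<le> card V - 3"
        for u w F'
      proof -
        have cV': "card (V - {u, w}) = card V - 2"
          using uw finV by (simp add: card_Diff_subset)
        have "F' \<subseteq> [V - {u, w}]\<^bsup>2\<^esup>"
          using F2 F' by (auto simp: nsets_def)
        then have "(\<exists>P. perfect_matching (V - {u, w}, [V - {u, w}]\<^bsup>2\<^esup> - F') P)
            \<or> blocking (V - {u, w}) F'"
          using less.hyps[of "V - {u, w}" F'] cV' 3 finV evenV that by auto
        then show ?thesis
          using perfect_matching_insert_pair[of V u w F' _ F] uw F' card_blocking[of "V - {u, w}" F']
            finV cV'
          by auto
      qed
      have dcard: "card {e \<in> F. u \<notin> e \<and> w \<notin> e} \<le> card F - card (D u)" for u w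
      proof -
        have "{e \<in> F. u \<notin> e \<and> w \<notin> e} \<subseteq> F - D u"
          by (auto simp: D_def)
        then have "card {e \<in> F. u \<notin> e \<and> w \<notin> e} \<le> card (F - D u)"
          using finF by (intro card_mono) auto
        also have "\<dots> = card F - card (D u)"
          using finD by (intro card_Diff_subset) (auto simp: D_def)
        finally show ?thesis .
      qed
      show "\<exists>P. perfect_matching (V, [V]\<^bsup>2\<^esup> - F) P"
      proof (rule ccontr)
        assume no: "\<not> ?thesis"
        \<comment> \<open>Deleting a vertex of degree three or more leaves at most
          \<open>card V - 4\<close> missing edges, too few to block.\<close>
        have deg2: "card (D u) \<le> 2" for u
        proof (rule ccontr)
          assume big: "\<not> card (D u) \<le> 2"
          then have "D u \<noteq> {}" by auto
          then have "u \<in> V" using F2 by (auto simp: D_def nsets_def)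
          then obtain w where "w \<in> V" "w \<noteq> u" "{u, w} \<notin> F"
            using exists_nonadjacent[OF finV _ F2 cardF unblocked] by metis
          moreover have "card {e \<in> F. u \<notin> e \<and> w \<notin> e} \<le> card V - 4"
            using dcard[of u w] big cardF by linarith
          ultimately show False
            using delete[of u w "{e \<in> F. u \<notin> e \<and> w \<notin> e}"] no \<open>u \<in> V\<close> 3 by fastforce
        qed
        \<comment> \<open>A blocking star would span at least four vertices, giving its centre
          degree at least three against \<open>deg2\<close>. Only the triangle survives.\<close>
        have triangle: "\<exists>T\<subseteq>V - {u, w}. card V = 6 \<and> card T = 3 \<and> F' = [T]\<^bsup>2\<^esup>"
          if uw: "u \<in> V" "w \<in> V" "u \<noteq> w" "blocking (V - {u, w}) F'" "F' \<subseteq> F" for u w F'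
        proof -
          have cV': "card (V - {u, w}) = card V - 2"
            using uw finV by (simp add: card_Diff_subset)
          have False if c: "c \<in> V - {u, w}" "F' = star_edges c (V - {u, w})" for c
          proof -
            have "F' \<subseteq> D c"
              using c \<open>F' \<subseteq> F\<close> by (auto simp: D_def star_edges_def)
            then have "card F' \<le> 2"
              using card_mono[OF finD] deg2 le_trans by blast
            then show False
              using c card_star_edges[of "V - {u, w}" c] finV cV' 3 by auto
          qed
          then obtain T where "card (V - {u, w}) = 4" "T \<subseteq> V - {u, w}" "card T = 3" "F' = [T]\<^bsup>2\<^esup>"
            using uw(4) unfolding blocking_def by metis
          moreover then have "card V = 6" using cV' by linarith
          ultimately show ?thesis by blast
        qed
        \<comment> \<open>The two triangle edges at \<open>t\<close> already exhaust the degree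
          allowed by \<open>deg2\<close>.\<close>
        have inT: "D t \<subseteq> [T]\<^bsup>2\<^esup>" if T: "card T = 3" "[T]\<^bsup>2\<^esup> \<subseteq> F" "t \<in> T" for t T
        proof -
          obtain x y where xy: "T = {t, x, y}" "distinct [t, x, y]"
          proof -
            have "card (T - {t}) = 2" using T by simp
            then obtain x y where "T - {t} = {x, y}" "x \<noteq> y" by (auto simp: card_2_iff)
            then show ?thesis using that[of x y] T(3) by auto
          qed
          have sub: "{{t, x}, {t, y}} \<subseteq> D t"
            using T(2) xy by (auto simp: D_def nsets_2_triple)
          have "card {{t, x}, {t, y}} = 2"
            using xy by (auto simp: doubleton_eq_iff)
          then have "D t = {{t, x}, {t, y}}"
            using sub deg2 finD by (metis card_seteq)
          then show ?thesis using xy by (auto simp: nsets_2_triple)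
        qed
        \<comment> \<open>If \<open>u\<close> had degree two, deleting it with a neighbour
          \<open>w\<close> would leave a missing triangle \<open>T\<close> among six vertices. By
          \<open>inT\<close> no missing edge joins \<open>u\<close> to \<open>T\<close>, and
          \<open>{u, w}\<close> is present, so only one vertex remains as the other end of a missing
          edge at \<open>u\<close>.\<close>
        have deg1: "card (D u) \<le> 1" for u
        proof (rule ccontr)
          assume big: "\<not> card (D u) \<le> 1"
          then have two: "card (D u) = 2" using deg2[of u] by auto
          then have "D u \<noteq> {}" by auto
          then have u: "u \<in> V" using F2 by (auto simp: D_def nsets_def)
          then obtain w where w: "w \<in> V" "w \<noteq> u" "{u, w} \<notin> F"
            using exists_nonadjacent[OF finV _ F2 cardF unblocked] by metis
          define F' where "F' = {e \<in> F. u \<notin> e \<and> w \<notin> e}"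
          have c3: "card F' \<le> card V - 3"
            using dcard[of u w] two cardF unfolding F'_def by linarith
          have "blocking (V - {u, w}) F'"
            using delete[OF u w(1) w(2)[symmetric] w(3) F'_def] c3 no by blast
          then obtain T where T: "T \<subseteq> V - {u, w}" "card V = 6" "card T = 3" "F' = [T]\<^bsup>2\<^esup>"
            using triangle[of u w F'] u w by (auto simp: F'_def)
          have "[T]\<^bsup>2\<^esup> \<subseteq> F" using T(4) by (auto simp: F'_def)
          have sub: "D u \<subseteq> (\<lambda>x. {u, x}) ` (V - {u, w} - T)"
          proof
            fix e assume e: "e \<in> D u"
            then have "e \<in> [V]\<^bsup>2\<^esup>" "u \<in> e" "e \<in> F" using F2 by (auto simp: D_def)
            then obtain x where x: "e = {u, x}" "x \<noteq> u" "x \<in> V"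
              by (auto simp: nsets_2_eq)
            have "x \<notin> T"
            proof
              assume "x \<in> T"
              then have "e \<in> [T]\<^bsup>2\<^esup>"
                using inT[OF T(3) \<open>[T]\<^bsup>2\<^esup> \<subseteq> F\<close>, of x] x(1) \<open>e \<in> F\<close> unfolding D_def by blast
              then have "u \<in> T" using x by (auto simp: nsets_def)
              then show False using T by auto
            qed
            moreover have "x \<noteq> w" using w x \<open>e \<in> F\<close> by auto
            ultimately show "e \<in> (\<lambda>x. {u, x}) ` (V - {u, w} - T)" using x by auto
          qed
          have finT: "finite T" using T finV finite_subset by blast
          have "card (V - {u, w} - T) = 1"
            using T u w finV finT by (simp add: card_Diff_subset)
          then have "card (D u) \<le> 1"
            using sub finV by (metis finite_Diff surj_card_le)
          then show False using two by simp
        qed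
        \<comment> \<open>By \<open>deg1\<close> the missing edges are pairwise disjoint. One end
          from each of two of them gives an adjacent pair that removes both; with at most one
          missing edge, any adjacent pair satisfies the bound.\<close>
        have pair: "\<exists>u w. u \<in> V \<and> w \<in> V \<and> u \<noteq> w \<and> {u, w} \<notin> F
            \<and> card {e \<in> F. u \<notin> e \<and> w \<notin> e} \<le> card V - 3"
        proof (cases "card F \<le> 1")
          case True
          obtain u where u: "u \<in> V" using 3 by fastforce
          then obtain w where w: "w \<in> V" "w \<noteq> u" "{u, w} \<notin> F"
            using exists_nonadjacent[OF finV _ F2 cardF unblocked] by metis
          have "card {e \<in> F. u \<notin> e \<and> w \<notin> e} \<le> card F"
            using finF by (intro card_mono) auto
          then have "card {e \<in> F. u \<notin> e \<and> w \<notin> e} \<le> card V - 3" using True 3 by linarith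
          then show ?thesis using u w by blast
        next
          case False
          then obtain e1 e2 where e: "e1 \<in> F" "e2 \<in> F" "e1 \<noteq> e2"
            using finF by (metis One_nat_def card_le_Suc0_iff_eq)
          then have "e1 \<in> [V]\<^bsup>2\<^esup>" "e2 \<in> [V]\<^bsup>2\<^esup>" using F2 by auto
          then obtain u w where uw: "u \<in> e1" "w \<in> e2" "u \<in> V" "w \<in> V"
            by (auto simp: nsets_2_eq)
          have uniq: "e = e'" if "e \<in> F" "e' \<in> F" "x \<in> e" "x \<in> e'" for e e' x
            using deg1[of x] that finD[of x] by (auto simp: D_def card_le_Suc0_iff_eq)
          have "u \<noteq> w" using uniq e uw by metis
          moreover have "{u, w} \<notin> F" using uniq e uw by (metis insertCI)
          moreover have "card {e \<in> F. u \<notin> e \<and> w \<notin> e} \<le> card V - 3"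
          proof -
            have "{e \<in> F. u \<notin> e \<and> w \<notin> e} \<subseteq> F - {e1, e2}" using uw by auto
            then have "card {e \<in> F. u \<notin> e \<and> w \<notin> e} \<le> card (F - {e1, e2})"
              using finF by (intro card_mono) auto
            also have "\<dots> = card F - 2" using e finF by (simp add: card_Diff_subset)
            finally show ?thesis using cardF by auto
          qed
          ultimately show ?thesis using uw by blast
        qed
        then obtain u w where uw: "u \<in> V" "w \<in> V" "u \<noteq> w" "{u, w} \<notin> F"
          "card {e \<in> F. u \<notin> e \<and> w \<notin> e} \<le> card V - 3" by blast
        then have "blocking (V - {u, w}) {e \<in> F. u \<notin> e \<and> w \<notin> e}"
          using delete[of u w, OF _ _ _ _ refl] no by blast
        then obtain T where T: "card T = 3" "[T]\<^bsup>2\<^esup> = {e \<in> F. u \<notin> e \<and> w \<notin> e}"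
          using triangle[of u w "{e \<in> F. u \<notin> e \<and> w \<notin> e}"] uw by auto
        \<comment> \<open>A corner of the missing triangle has degree two, contradicting
          \<open>deg1\<close>.\<close>
        obtain a b c where abc: "T = {a, b, c}" "distinct [a, b, c]"
          using T(1) by (auto simp: card_3_iff)
        have "{{a, b}, {a, c}} \<subseteq> D a"
        proof -
          have "{{a, b}, {a, c}} \<subseteq> [T]\<^bsup>2\<^esup>"
            using nsets_2_triple[OF abc(2)] abc(1) by simp
          then have "{{a, b}, {a, c}} \<subseteq> F" using T(2) by simp
          then show ?thesis by (simp add: D_def)
        qed
        then have "card {{a, b}, {a, c}} \<le> card (D a)"
          using card_mono[OF finD] by blast
        then have "card {{a, b}, {a, c}} \<le> 1"
          using deg1 le_trans by blast
        then show False using abc(2) by (auto simp: doubleton_eq_iff)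
      qed
    qed
  qed
qed

section \<open>Recognising disjoint unions, joins, complete and edgeless graphs up to
  isomorphism\<close>

lemma Inl_edge_iff: "{Inl a, Inl b} \<in> image Inl ` E \<longleftrightarrow> {a, b} \<in> E"
  using inj_image_mem_iff[of "image Inl" "{a, b}" E] by (simp add: inj_on_def inj_image_eq_iff)

lemma Inr_edge_iff: "{Inr a, Inr b} \<in> image Inr ` E \<longleftrightarrow> {a, b} \<in> E"
  using inj_image_mem_iff[of "image Inr" "{a, b}" E] by (simp add: inj_on_def inj_image_eq_iff)

lemma edges_disjoint_union_iff:
  "{Inl a, Inl b} \<in> edges (disjoint_union G H) \<longleftrightarrow> {a, b} \<in> edges G"
  "{Inr c, Inr d} \<in> edges (disjoint_union G H) \<longleftrightarrow> {c, d} \<in> edges H"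
  "{Inl a, Inr d} \<notin> edges (disjoint_union G H)"
  "{Inr d, Inl a} \<notin> edges (disjoint_union G H)"
proof -
  have "e \<noteq> Inr ` y" if "Inl x \<in> e" for e x y
    using that by auto
  moreover have "e \<noteq> Inl ` y" if "Inr x \<in> e" for e x y
    using that by auto
  ultimately show "{Inl a, Inl b} \<in> edges (disjoint_union G H) \<longleftrightarrow> {a, b} \<in> edges G"
    "{Inr c, Inr d} \<in> edges (disjoint_union G H) \<longleftrightarrow> {c, d} \<in> edges H"
    "{Inl a, Inr d} \<notin> edges (disjoint_union G H)"
    "{Inr d, Inl a} \<notin> edges (disjoint_union G H)"
    unfolding disjoint_union_def snd_conv Un_iff Inl_edge_iff Inr_edge_iff
    by blast+
qed

lemma edges_join_iff:
  "{Inl a, Inl b} \<in> edges (join G H) \<longleftrightarrow> {a, b} \<in> edges G"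
  "{Inr c, Inr d} \<in> edges (join G H) \<longleftrightarrow> {c, d} \<in> edges H"
  "{Inl a, Inr d} \<in> edges (join G H) \<longleftrightarrow> a \<in> verts G \<and> d \<in> verts H"
  "{Inr d, Inl a} \<in> edges (join G H) \<longleftrightarrow> a \<in> verts G \<and> d \<in> verts H"
  by (auto simp: join_def edges_disjoint_union_iff doubleton_eq_iff)

lemma bij_betw_Plus:
  assumes "bij_betw g A A'" "bij_betw h B B'" "A \<inter> B = {}"
  shows "bij_betw (\<lambda>x. if x \<in> A then Inl (g x) else Inr (h x)) (A \<union> B) (A' <+> B')"
  using assms by (auto simp: bij_betw_def inj_on_def image_iff split: if_splits)

text \<open>\<open>graph_iso\<close> tests only pairs of vertices, so \<open>(A, E)\<close> acts as
  the subgraph induced on \<open>A\<close> although \<open>E\<close> is not restricted. All pieces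
  of a graph can thus share its edge set.\<close>

lemma graph_iso_disjoint_union:
  assumes "A \<inter> B = {}" "(A, E) \<cong>\<^sub>G G" "(B, E) \<cong>\<^sub>G H"
    and cross: "\<And>u v. u \<in> A \<Longrightarrow> v \<in> B \<Longrightarrow> {u, v} \<notin> E"
  shows "(A \<union> B, E) \<cong>\<^sub>G disjoint_union G H"
proof -
  obtain g h where
    g: "bij_betw g A (verts G)" "\<forall>u\<in>A. \<forall>v\<in>A. {u, v} \<in> E \<longleftrightarrow> {g u, g v} \<in> edges G" and
    h: "bij_betw h B (verts H)" "\<forall>u\<in>B. \<forall>v\<in>B. {u, v} \<in> E \<longleftrightarrow> {h u, h v} \<in> edges H"
    using assms(2,3) by (auto simp: graph_iso_def)
  let ?f = "\<lambda>x. if x \<in> A then Inl (g x) else Inr (h x)"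
  have "bij_betw ?f (A \<union> B) (verts (disjoint_union G H))"
    using bij_betw_Plus[OF g(1) h(1) assms(1)] by (simp add: disjoint_union_def)
  moreover have "{u, v} \<in> E \<longleftrightarrow> {?f u, ?f v} \<in> edges (disjoint_union G H)"
    if "u \<in> A \<union> B" "v \<in> A \<union> B" for u v
    using that g(2) h(2) cross[of u v] cross[of v u]
    by (auto simp: edges_disjoint_union_iff insert_commute)
  ultimately show ?thesis
    unfolding graph_iso_def fst_conv snd_conv by blast
qed

lemma graph_iso_join:
  assumes "A \<inter> B = {}" "(A, E) \<cong>\<^sub>G G" "(B, E) \<cong>\<^sub>G H"
    and cross: "\<And>u v. u \<in> A \<Longrightarrow> v \<in> B \<Longrightarrow> {u, v} \<in> E"
  shows "(A \<union> B, E) \<cong>\<^sub>G join G H"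
proof -
  obtain g h where
    g: "bij_betw g A (verts G)" "\<forall>u\<in>A. \<forall>v\<in>A. {u, v} \<in> E \<longleftrightarrow> {g u, g v} \<in> edges G" and
    h: "bij_betw h B (verts H)" "\<forall>u\<in>B. \<forall>v\<in>B. {u, v} \<in> E \<longleftrightarrow> {h u, h v} \<in> edges H"
    using assms(2,3) by (auto simp: graph_iso_def)
  let ?f = "\<lambda>x. if x \<in> A then Inl (g x) else Inr (h x)"
  have "bij_betw ?f (A \<union> B) (verts (join G H))"
    using bij_betw_Plus[OF g(1) h(1) assms(1)] by (simp add: join_def disjoint_union_def)
  moreover have "g u \<in> verts G" if "u \<in> A" for u
    using g(1) that by (auto simp: bij_betw_def)
  moreover have "h u \<in> verts H" if "u \<in> B" for u
    using h(1) that by (auto simp: bij_betw_def)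
  ultimately have "{u, v} \<in> E \<longleftrightarrow> {?f u, ?f v} \<in> edges (join G H)"
    if "u \<in> A \<union> B" "v \<in> A \<union> B" for u v
    using that g(2) h(2) cross[of u v] cross[of v u]
    by (auto simp: edges_join_iff insert_commute)
  with \<open>bij_betw ?f (A \<union> B) (verts (join G H))\<close> show ?thesis
    unfolding graph_iso_def fst_conv snd_conv by blast
qed

text \<open>Singletons are excluded from \<open>E\<close> because \<open>graph_iso\<close> also
  compares \<open>{u, v}\<close> when \<open>u = v\<close>.\<close>

lemma graph_iso_complete_graph:
  assumes "finite A" "card A = r" "[A]\<^bsup>2\<^esup> \<subseteq> E" "\<And>u. u \<in> A \<Longrightarrow> {u} \<notin> E"
  shows "(A, E) \<cong>\<^sub>G complete_graph r"
proof -
  obtain f where f: "bij_betw f A {..<r}"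
    using assms(1,2) ex_bij_betw_finite_nat[of A] by (auto simp: lessThan_atLeast0)
  have "{u, v} \<in> E \<longleftrightarrow> {f u, f v} \<in> [{..<r}]\<^bsup>2\<^esup>" if "u \<in> A" "v \<in> A" for u v
  proof (cases "u = v")
    case True
    then show ?thesis using assms(4) that by (auto simp: nsets_def)
  next
    case False
    then have "{u, v} \<in> E" using assms(3) that by (auto simp: nsets_2_eq)
    moreover have "f u \<noteq> f v" "f u < r" "f v < r"
      using f that False by (auto simp: bij_betw_def inj_on_def)
    ultimately show ?thesis by (auto simp: nsets_def)
  qed
  then show ?thesis
    using f by (auto simp: graph_iso_def complete_graph_def)
qed

lemma graph_iso_edgeless_graph:
  assumes "finite A" "card A = t" "\<And>u v. u \<in> A \<Longrightarrow> v \<in> A \<Longrightarrow> {u, v} \<notin> E"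
  shows "(A, E) \<cong>\<^sub>G edgeless_graph t"
proof -
  obtain f where "bij_betw f A {..<t}"
    using assms(1,2) ex_bij_betw_finite_nat[of A] by (auto simp: lessThan_atLeast0)
  then show ?thesis
    using assms(3) by (auto simp: graph_iso_def edgeless_graph_def)
qed

section \<open>Extending a matching and identifying the exceptional graphs\<close>

lemma card_Union_matching:
  assumes "M \<subseteq> [V]\<^bsup>2\<^esup>" "pairwise disjnt M"
  shows "card (\<Union>M) = 2 * card M"
proof -
  have "card (\<Union>M) = (\<Sum>e\<in>M. card e)"
    using assms by (intro card_Union_disjoint) (auto simp: nsets_def)
  also have "\<dots> = (\<Sum>e\<in>M. 2)"
    using assms(1) by (intro sum.cong) (auto simp: nsets_def)
  finally show ?thesis by simp
qed

theorem theorem1p1: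
  fixes k n :: nat and G :: "'a graph"
  assumes "k > 0"
    and "n > 0" and "even n"
    and "finite_simple_graph G"
    and "connected_graph G"
    and "card (verts G) = n"
    and "card (edges G) \<ge> ((n - 1) choose 2) + 2 * k"
  shows "extendable k G
    \<or> G \<cong>\<^sub>G join (complete_graph (2 * k)) (disjoint_union (complete_graph (n - 2 * k - 1)) (complete_graph 1))
    \<or> G \<cong>\<^sub>G join (complete_graph (2 * k + 1)) (edgeless_graph 3)"
proof -
  obtain V E where G: "G = (V, E)" by (cases G)
  have finV: "finite V" and E2: "E \<subseteq> [V]\<^bsup>2\<^esup>" and cV: "card V = n"
    using assms(4,6) G by (auto simp: finite_simple_graph_def)
  have fin2: "finite ([V]\<^bsup>2\<^esup>)" using finV by (rule finite_imp_finite_nsets)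
  define F where "F = [V]\<^bsup>2\<^esup> - E"
  have F2: "F \<subseteq> [V]\<^bsup>2\<^esup>" and EF: "E = [V]\<^bsup>2\<^esup> - F" using E2 by (auto simp: F_def)
  have finF: "finite F" using F2 fin2 finite_subset by blast
  have "card F + card E = n choose 2"
    using E2 fin2 cV finite_subset[OF E2] card_mono[OF fin2 E2]
    by (simp add: F_def card_Diff_subset card_nsets)
  moreover have "n choose 2 = ((n - 1) choose 2) + (n - 1)"
    using assms(2) by (simp add: choose_reduce_nat[of n 2])
  \<comment> \<open>The bound on missing edges, kept additive to avoid truncated
    subtraction.\<close>
  ultimately have cF: "card F + 2 * k \<le> n - 1"
    using assms(7) G by auto
  have n2: "n \<ge> 2 * k + 2"
  proof -
    have "2 * k + 1 \<le> n" using cF assms(2) by linarith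
    moreover have "n \<noteq> 2 * k + 1" using assms(3) by auto
    ultimately show ?thesis by linarith
  qed
  have loop: "{u} \<notin> E" for u using E2 by (auto simp: nsets_def)
  show ?thesis
  proof (cases "extendable k G")
    case True
    then show ?thesis by blast
  next
    case False
    \<comment> \<open>As \<open>k > 0\<close>, fewer than \<open>n - 1\<close> edges are missing.
      Hence \<open>G\<close> has a perfect matching, and non-extendability must come from some
      matching \<open>M\<close> of size \<open>k\<close>.\<close>
    have "\<not> blocking V F"
      using card_blocking[OF finV, of F] cF cV assms(1) n2 by auto
    then have "\<exists>P. perfect_matching G P"
      using perfect_matching_avoiding[OF finV _ F2] cF cV assms(3) n2 G EF by auto
    then obtain M where M: "M \<subseteq> E" "pairwise disjnt M" "card M = k"
      and ext: "\<And>P. perfect_matching G P \<Longrightarrow> \<not> M \<subseteq> P"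
      using False n2 cV G by (auto simp: extendable_def matching_def)
    define U W where "U = \<Union>M" and "W = V - U"
    have UV: "U \<subseteq> V" using M(1) E2 by (auto simp: U_def nsets_def)
    have cU: "card U = 2 * k"
      using card_Union_matching[of M V] M E2 by (auto simp: U_def)
    have finU: "finite U" and finW: "finite W"
      using UV finV finite_subset by (auto simp: W_def)
    have cW: "card W = n - 2 * k"
      using UV finU cU cV by (simp add: W_def card_Diff_subset)
    have VUW: "V = U \<union> W" "U \<inter> W = {}" using UV by (auto simp: W_def)
    define F' where "F' = F \<inter> [W]\<^bsup>2\<^esup>"
    have "F' \<subseteq> F" by (auto simp: F'_def)
    have cF': "card F' \<le> card F" using finF \<open>F' \<subseteq> F\<close> by (rule card_mono)
    \<comment> \<open>Such a \<open>P\<close> together with \<open>M\<close> would be a perfect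
      matching of \<open>G\<close> extending \<open>M\<close>.\<close>
    have False if "perfect_matching (W, [W]\<^bsup>2\<^esup> - F') P" for P
    proof -
      have P: "P \<subseteq> [W]\<^bsup>2\<^esup> - F'" "pairwise disjnt P" "\<Union>P = W"
        using that by (auto simp: perfect_matching_def matching_def)
      have "[W]\<^bsup>2\<^esup> \<subseteq> [V]\<^bsup>2\<^esup>" by (auto simp: W_def nsets_def)
      then have "P \<subseteq> E" using P(1) by (auto simp: EF F'_def)
      moreover have "disjnt e e'" if "e \<in> M" "e' \<in> P" for e e'
        using that P(3) by (auto simp: disjnt_def U_def W_def)
      then have "pairwise disjnt (M \<union> P)"
        using M(2) P(2) by (auto simp: pairwise_def disjnt_sym)
      ultimately have "perfect_matching G (M \<union> P)"
        using M(1) P(3) VUW(1) by (simp add: perfect_matching_def matching_def G U_def)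
      then show False using ext by blast
    qed
    moreover have "card F' < card W" "even (card W)" "F' \<subseteq> [W]\<^bsup>2\<^esup>"
      using cF cF' cW n2 assms(3) by (auto simp: F'_def)
    ultimately have block: "blocking W F'"
      using perfect_matching_avoiding[OF finW] by blast
    then have "card F' = n - 2 * k - 1"
      using card_blocking[OF finW block] cW by simp
    \<comment> \<open>Blocking forces \<open>F'\<close> to reach the upper bound \<open>cF\<close>
      on \<open>card F\<close>, so every missing edge lies inside \<open>W\<close> and the vertices
      of \<open>U\<close> are adjacent to all others.\<close>
    then have FF': "F = F'"
      using cF finF \<open>F' \<subseteq> F\<close> by (intro card_seteq[symmetric]) auto
    have edgeI: "{u, v} \<in> E" if "u \<in> V" "v \<in> V" "u \<noteq> v" "{u, v} \<notin> F" for u v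
      using that by (auto simp: EF nsets_def)
    have cross: "{u, v} \<in> E" if "u \<in> V - X" "v \<in> X" "X \<subseteq> V" "F \<subseteq> [X]\<^bsup>2\<^esup>" for u v X
      using that by (intro edgeI) (auto simp: nsets_def)
    have complete: "(A, E) \<cong>\<^sub>G complete_graph (card A)" if "A \<subseteq> V" "[A]\<^bsup>2\<^esup> \<inter> F = {}" for A
    proof (rule graph_iso_complete_graph)
      show "finite A" using that(1) finV finite_subset by blast
      have "[A]\<^bsup>2\<^esup> \<subseteq> [V]\<^bsup>2\<^esup>" using that(1) by (auto simp: nsets_def)
      then show "[A]\<^bsup>2\<^esup> \<subseteq> E" using that(2) by (auto simp: EF)
    qed (simp_all add: loop)
    consider (star) c where "c \<in> W" "F = star_edges c W"
      | (triangle) T where "card W = 4" "T \<subseteq> W" "card T = 3" "F = [T]\<^bsup>2\<^esup>"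
      using block FF' by (auto simp: blocking_def)
    then show ?thesis
    proof cases
      case star
      \<comment> \<open>Every missing edge contains \<open>c\<close>, so \<open>W - {c}\<close> is
        complete, while \<open>c\<close> has no neighbour in \<open>W\<close>; \<open>U\<close>
        supplies the other side of the join.\<close>
      have "(W - {c}, E) \<cong>\<^sub>G complete_graph (n - 2 * k - 1)"
        using complete[of "W - {c}"] star cW finW VUW by (auto simp: star_edges_def nsets_def)
      moreover have "({c}, E) \<cong>\<^sub>G complete_graph 1"
        using complete[of "{c}"] star VUW by (auto simp: star_edges_def nsets_def)
      ultimately have "((W - {c}) \<union> {c}, E) \<cong>\<^sub>G
          disjoint_union (complete_graph (n - 2 * k - 1)) (complete_graph 1)"
        using star by (intro graph_iso_disjoint_union) (auto simp: EF star_edges_def insert_commute)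
      moreover have "(W - {c}) \<union> {c} = W" using star by auto
      moreover have "(U, E) \<cong>\<^sub>G complete_graph (2 * k)"
        using complete[of U] cU star VUW by (auto simp: star_edges_def nsets_def)
      moreover have "F \<subseteq> [W]\<^bsup>2\<^esup>" using FF' by (auto simp: F'_def)
      ultimately have "(U \<union> W, E) \<cong>\<^sub>G join (complete_graph (2 * k))
          (disjoint_union (complete_graph (n - 2 * k - 1)) (complete_graph 1))"
        using VUW cross[of _ W] by (intro graph_iso_join) auto
      then show ?thesis using G VUW by simp
    next
      case triangle
      have TV: "T \<subseteq> V" using triangle VUW by auto
      have finT: "finite T" using TV finV finite_subset by blast
      \<comment> \<open>The vertex of \<open>W\<close> outside \<open>T\<close> meets no missing
        edge, so it is grouped with the \<open>2 * k\<close> vertices of \<open>U\<close>; this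
        yields the \<open>2 * k + 1\<close> of the second exception.\<close>
      have "n = 2 * k + 4" using triangle cW by simp
      then have "card (V - T) = 2 * k + 1"
        using TV finT triangle cV by (simp add: card_Diff_subset)
      moreover have "[V - T]\<^bsup>2\<^esup> \<inter> F = {}" by (auto simp: triangle nsets_2_eq)
      ultimately have "(V - T, E) \<cong>\<^sub>G complete_graph (2 * k + 1)"
        using complete[of "V - T"] by auto
      moreover have "(T, E) \<cong>\<^sub>G edgeless_graph 3"
        using finT triangle loop by (intro graph_iso_edgeless_graph) (auto simp: EF nsets_def card_insert_if)
      ultimately have "(V - T \<union> T, E) \<cong>\<^sub>G join (complete_graph (2 * k + 1)) (edgeless_graph 3)"
        using TV triangle cross[of _ T] by (intro graph_iso_join) auto
      moreover have "V - T \<union> T = V" using TV by auto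
      ultimately show ?thesis using G by simp
    qed
  qed
qed

end
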